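(* Let $n\ge1$, $1/2<s<1$, let $\Omega\subset\mathbb R^n$ be either the ball $B_R=\{|x|<R\}$, $R>0$ (in which case set $R_0=0$), or the annulus $A_{R_0,R}=\{R_0<|x|<R\}$, $0<R_0<R$, and let $M,\delta>0$. Let $\mathcal C$ denote $\mathcal C_+(\Omega)$ or, if $\Omega=A_{R_0,R}$, either of $\mathcal C_+(\Omega)$, $\mathcal C_-(\Omega)$. There exist two positive constants $K_\infty=K_\infty(R_0,R,n,s,M,\delta)$ and $K_2=K_2(R_0,R,n,s,M,\delta)$ such that, for every $g\in\mathfrak F_{M,\delta}$ and every weak solution $u\in\mathcal C$ of $$(-\Delta)^su+u=g(u)\ \text{ in }\Omega,\qquad u\ge0\ \text{ in }\Omega,\qquad \mathcal N_su=0\ \text{ in }\mathbb R^n\setminus\overline\Omega ,$$ the following estimates hold: $$\|u\|_{L^\infty(\Omega)}\le K_\infty\qquad\text{and}\qquad\|u\|_{H^s_{\Omega,0}}\le K_2 .$$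
   Context: Write $\Omega^c=\mathbb R^n\setminus\Omega$; $c_{n,s}>0$ is the normalization constant of the fractional Laplacian $(-\Delta)^su(x)=c_{n,s}\,\mathrm{PV}\int_{\mathbb R^n}\frac{u(x)-u(y)}{|x-y|^{n+2s}}dy$, and $\mathcal N_su(x)=c_{n,s}\int_\Omega\frac{u(x)-u(y)}{|x-y|^{n+2s}}dy$ for $x\in\mathbb R^n\setminus\overline\Omega$. $[u]_{H^s_{\Omega,0}}=\big(\frac{c_{n,s}}2\iint_{\mathbb R^{2n}\setminus(\Omega^c)^2}\frac{|u(x)-u(y)|^2}{|x-y|^{n+2s}}dxdy\big)^{1/2}$; $H^s_{\Omega,0}$ is the space of measurable $u:\mathbb R^n\to\mathbb R$ with $u\in L^2(\Omega)$ and $[u]_{H^s_{\Omega,0}}<\infty$, with norm $\|u\|_{H^s_{\Omega,0}}=\|u\|_{L^2(\Omega)}+[u]_{H^s_{\Omega,0}}$. Identifying radial functions with functions of $|x|$, $\mathcal C_+(\Omega)$ (resp. $\mathcal C_-(\Omega)$, used only for the annulus) is the set of $u\in H^s_{\Omega,0}$ that are radial, $u\ge0$ in $\mathbb R^n$, and $u(r)\le u(\rho)$ (resp. $u(r)\ge u(\rho)$) for all $R_0\le r\le\rho\le R$. $\mathfrak F_{M,\delta}=\{g\in C([0,\infty)): g\ge0,\ g(t)\ge(1+\delta)t\text{ for all }t\ge M\}$. A non-negative $u\in H^s_{\Omega,0}$ is a weak solution of the problem if for every $v\in H^s_{\Omega,0}$ $$\frac{c_{n,s}}2\iint_{\mathbb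 R^{2n}\setminus(\Omega^c)^2}\frac{(u(x)-u(y))(v(x)-v(y))}{|x-y|^{n+2s}}dxdy+\int_\Omega uv\,dx=\int_\Omega g(u)v\,dx .$$ *)

theory Defs
  imports "HOL-Analysis.Analysis" "HOL-Probability.Essential_Supremum"
begin

text \<open>
  The constant for which \<^emph>\<open>c\<close> times the principal value integral of
  \<open>(u x - u y) / |x - y| ^ (n + 2 s)\<close> has Fourier symbol \<open>|\<xi>| ^ (2 s)\<close>
  (for \<open>0 < s < 1\<close>; there \<open>Gamma (- s) < 0\<close>).
\<close>

definition frac_laplacian_const :: "nat \<Rightarrow> real \<Rightarrow> real" where
  "frac_laplacian_const n s =
     4 powr s * Gamma (real n / 2 + s) / (pi powr (real n / 2) * \<bar>Gamma (- s)\<bar>)"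

definition cross_region :: "'a set \<Rightarrow> ('a \<times> 'a) set" where
  "cross_region \<Omega> = UNIV - (- \<Omega>) \<times> (- \<Omega>)"

text \<open>
  All measurability is Lebesgue measurability; \<^term>\<open>lebesgue\<close> on the product type
  \<open>(real ^ 'n) \<times> (real ^ 'n)\<close> is Lebesgue measure in dimension \<open>2 n\<close>. On the diagonal the
  kernel quotients below are \<open>0 / 0 = 0\<close>, which is immaterial as the diagonal is a null set.
\<close>

definition gagliardo_energy :: "real \<Rightarrow> (real ^ 'n) set \<Rightarrow> (real ^ 'n \<Rightarrow> real) \<Rightarrow> ennreal" where
  "gagliardo_energy s \<Omega> u =
     (\<integral>\<^sup>+ z \<in> cross_region \<Omega>.
        (case z of (x, y) \<Rightarrow>
           ennreal (\<bar>u x - u y\<bar> ^ 2 / norm (x - y) powr (real CARD('n) + 2 * s))) \<partial>lebesgue)"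

definition Hs_seminorm :: "real \<Rightarrow> (real ^ 'n) set \<Rightarrow> (real ^ 'n \<Rightarrow> real) \<Rightarrow> real" where
  "Hs_seminorm s \<Omega> u =
     sqrt (frac_laplacian_const CARD('n) s / 2 * enn2real (gagliardo_energy s \<Omega> u))"

definition Hs_space :: "real \<Rightarrow> (real ^ 'n) set \<Rightarrow> (real ^ 'n \<Rightarrow> real) set" where
  "Hs_space s \<Omega> =
     {u. u \<in> borel_measurable lebesgue \<and>
         set_integrable lebesgue \<Omega> (\<lambda>x. \<bar>u x\<bar> ^ 2) \<and>
         gagliardo_energy s \<Omega> u < \<infinity>}"

definition Hs_norm :: "real \<Rightarrow> (real ^ 'n) set \<Rightarrow> (real ^ 'n \<Rightarrow> real) \<Rightarrow> real" where
  "Hs_norm s \<Omega> u = sqrt (LINT x:\<Omega>|lebesgue. \<bar>u x\<bar> ^ 2) + Hs_seminorm s \<Omega> u"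

text \<open>The ball for \<open>R0 = 0\<close> (including the origin), the annulus for \<open>R0 > 0\<close>.\<close>

definition radial_domain :: "real \<Rightarrow> real \<Rightarrow> (real ^ 'n) set" where
  "radial_domain R0 R =
     (if R0 = 0 then {x. norm x < R} else {x. R0 < norm x \<and> norm x < R})"

text \<open>In both cones \<open>f\<close> is the radial profile of \<open>u\<close>.\<close>

definition cone_plus :: "real \<Rightarrow> real \<Rightarrow> real \<Rightarrow> (real ^ 'n \<Rightarrow> real) set" where
  "cone_plus s R0 R =
     {u \<in> Hs_space s (radial_domain R0 R).
        (\<forall>x. 0 \<le> u x) \<and> (\<exists>f. (\<forall>x. u x = f (norm x)) \<and> mono_on {R0..R} f)}"

definition cone_minus :: "real \<Rightarrow> real \<Rightarrow> real \<Rightarrow> (real ^ 'n \<Rightarrow> real) set" where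
  "cone_minus s R0 R =
     {u \<in> Hs_space s (radial_domain R0 R).
        (\<forall>x. 0 \<le> u x) \<and> (\<exists>f. (\<forall>x. u x = f (norm x)) \<and> antimono_on {R0..R} f)}"

text \<open>Only the values on \<open>[0, \<infinity>)\<close> matter; \<open>g\<close> is arbitrary on the negative reals.\<close>

definition nonlinearities :: "real \<Rightarrow> real \<Rightarrow> (real \<Rightarrow> real) set" where
  "nonlinearities M \<delta> =
     {g. continuous_on {0..} g \<and> (\<forall>t\<ge>0. 0 \<le> g t) \<and> (\<forall>t\<ge>0. M \<le> t \<longrightarrow> (1 + \<delta>) * t \<le> g t)}"

text \<open>
  The two integrals on the left exist for all \<open>u, v\<close> in the space by Cauchy-Schwarz. The integral
  of \<open>g(u) v\<close> need not for general \<open>g\<close>, and a non-integrable function has integral \<open>0\<close>, so its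
  existence is demanded explicitly.
\<close>

definition weak_solution ::
  "real \<Rightarrow> (real ^ 'n) set \<Rightarrow> (real \<Rightarrow> real) \<Rightarrow> (real ^ 'n \<Rightarrow> real) \<Rightarrow> bool" where
  "weak_solution s \<Omega> g u \<longleftrightarrow>
     u \<in> Hs_space s \<Omega> \<and> (\<forall>x. 0 \<le> u x) \<and>
     (\<forall>v \<in> Hs_space s \<Omega>.
        set_integrable lebesgue \<Omega> (\<lambda>x. g (u x) * v x) \<and>
        frac_laplacian_const CARD('n) s / 2 *
          (LINT z:cross_region \<Omega>|lebesgue.
             (case z of (x, y) \<Rightarrow>
                (u x - u y) * (v x - v y) / norm (x - y) powr (real CARD('n) + 2 * s)))
        + (LINT x:\<Omega>|lebesgue. u x * v x)
        = (LINT x:\<Omega>|lebesgue. g (u x) * v x))"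

definition Linfty_norm :: "(real ^ 'n) set \<Rightarrow> (real ^ 'n \<Rightarrow> real) \<Rightarrow> ereal" where
  "Linfty_norm \<Omega> u = esssup (lebesgue_on \<Omega>) (\<lambda>x. ereal \<bar>u x\<bar>)"

end

theory Submission
  imports Defs
begin

text \<open>
  Testing with \<open>v = 1\<close> and using \<open>g t \<ge> (1 + \<delta>) * (t - M)\<close> bounds the integrals of
  \<open>u\<close> and \<open>g(u)\<close>, which are equal, over \<open>\<Omega>\<close>. Since \<open>u\<close> is radial and monotone and \<open>s > 1/2\<close>, its supremum is
  at most a multiple of the integral of \<open>u\<close> plus a multiple of the square root of its energy \<open>E\<close>.
  Testing with \<open>v = u\<close> then bounds \<open>E\<close> by \<open>sup u\<close> times the integral of \<open>g(u)\<close>, that is by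
  \<open>a + b * sqrt E\<close>, so \<open>E\<close> is bounded, and with it \<open>sup u\<close>.
  The two cones are treated together by writing \<open>u x = F (\<sigma> * (norm x - e))\<close> with \<open>F\<close> decreasing:
  \<open>e\<close> is the radius at which \<open>u\<close> is largest, and \<open>\<sigma> = 1\<close> or \<open>\<sigma> = -1\<close> points into the domain.
\<close>

section \<open>Volumes of shells and of sets of close pairs\<close>

text \<open>The exact volume is a multiple of the difference of the n-th powers of \<open>b\<close>
  and \<open>a\<close>; estimating all but one factor \<open>a\<close> of the second power by
  \<open>b\<close> leaves the width times a power of the outer radius.\<close>

lemma emeasure_shell_ge:
  fixes a b :: real
  assumes "0 \<le> a" "a < b"
  shows "ennreal (unit_ball_vol DIM('a) * ((b - a) * b ^ (DIM('a) - 1)))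
    \<le> emeasure lborel {x :: 'a::euclidean_space. a < norm x \<and> norm x < b}"
proof -
  obtain m where m: "DIM('a) = Suc m"
    by (metis DIM_positive Suc_pred)
  have "a * a ^ m \<le> a * b ^ m"
    using assms by (intro mult_left_mono power_mono) auto
  then have "(b - a) * b ^ m \<le> b ^ Suc m - a ^ Suc m"
    by (simp add: algebra_simps)
  then have "unit_ball_vol DIM('a) * ((b - a) * b ^ m) \<le> unit_ball_vol DIM('a) * (b ^ Suc m - a ^ Suc m)"
    by (intro mult_left_mono) auto
  also have "ennreal \<dots> = ennreal (unit_ball_vol DIM('a) * b ^ Suc m) - ennreal (unit_ball_vol DIM('a) * a ^ Suc m)"
    using assms by (subst ennreal_minus) (auto simp: right_diff_distrib)
  also have "\<dots> = emeasure lborel (ball 0 b :: 'a set) - emeasure lborel (cball 0 a :: 'a set)"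
    using assms by (simp add: emeasure_ball emeasure_cball m)
  also have "\<dots> = emeasure lborel (ball 0 b - cball 0 a :: 'a set)"
    using assms by (subst emeasure_Diff) (auto simp: emeasure_cball)
  also have "ball 0 b - cball 0 a = {x :: 'a. a < norm x \<and> norm x < b}"
    by auto
  finally show ?thesis
    using m by (simp add: ennreal_leI)
qed

text \<open>Each \<open>x\<close> in the first shell is paired with a ball around its radial
  projection onto the middle sphere of the second shell. The radius is half the width of the second
  shell, so the ball stays inside it, and Tonelli integrates its constant volume over
  \<open>x\<close>.\<close>

lemma emeasure_close_pairs_ge:
  fixes a b c e D :: real
  assumes "0 \<le> a" "a < b" "0 \<le> c" "c < e" "b - c \<le> D" "e - a \<le> D"
  shows "ennreal (unit_ball_vol DIM('a) * ((b - a) * b ^ (DIM('a) - 1)) *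
      (unit_ball_vol DIM('a) * ((e - c) / 2) ^ DIM('a)))
    \<le> emeasure lborel {z :: 'a \<times> 'a::euclidean_space.
        a < norm (fst z) \<and> norm (fst z) < b \<and> c < norm (snd z) \<and> norm (snd z) < e \<and>
        norm (fst z - snd z) < D}" (is "_ \<le> emeasure lborel ?T")
proof -
  define A where "A = {x :: 'a. a < norm x \<and> norm x < b}"
  define w m where "w = (e - c) / 2" and "m = (c + e) / 2"
  have "open ?T"
    by (intro open_Collect_conj open_Collect_less continuous_intros)
  then have T: "?T \<in> sets borel" by simp
  then have T': "?T \<in> sets (borel \<Otimes>\<^sub>M borel)" by (simp only: borel_prod)
  have "open A"
    unfolding A_def by (intro open_Collect_conj open_Collect_less continuous_intros)
  then have A: "A \<in> sets borel" by simp
  have w: "0 \<le> w" using assms by (simp add: w_def)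
  have slice: "ball ((m / norm x) *\<^sub>R x) w \<subseteq> Pair x -` ?T" if "x \<in> A" for x
  proof
    fix y assume "y \<in> ball ((m / norm x) *\<^sub>R x) w"
    then have y: "norm (y - (m / norm x) *\<^sub>R x) < w"
      by (simp add: dist_norm norm_minus_commute)
    have x: "a < norm x" "norm x < b" "norm x > 0" using that assms by (auto simp: A_def)
    have nm: "norm ((m / norm x) *\<^sub>R x) = m"
      using x assms by (simp add: m_def)
    have "\<bar>norm y - m\<bar> < w"
      using norm_triangle_ineq3[of y "(m / norm x) *\<^sub>R x"] y nm by linarith
    then have 1: "c < norm y" "norm y < e" unfolding w_def m_def by (auto simp: field_simps)
    have "x - (m / norm x) *\<^sub>R x = ((norm x - m) / norm x) *\<^sub>R x"
      using x by (simp add: diff_divide_distrib scaleR_left_diff_distrib)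
    then have "norm (x - (m / norm x) *\<^sub>R x) = \<bar>norm x - m\<bar>"
      using x by simp
    then have "norm (x - y) < \<bar>norm x - m\<bar> + w"
      using norm_triangle_ineq[of "x - (m / norm x) *\<^sub>R x" "(m / norm x) *\<^sub>R x - y"] y
      by (simp add: norm_minus_commute)
    \<comment> \<open>As \<open>m - w = c\<close> and \<open>m + w = e\<close>, the left side is
      \<open>norm x - c\<close> or \<open>e - norm x\<close>, according to the side of
      \<open>m\<close> on which \<open>norm x\<close> lies.\<close>
    also have "\<dots> \<le> D"
      using x assms unfolding w_def m_def by (auto simp: field_simps abs_if)
    finally show "y \<in> Pair x -` ?T" using 1 x by simp
  qed
  have "ennreal (unit_ball_vol DIM('a) * ((b - a) * b ^ (DIM('a) - 1)) * (unit_ball_vol DIM('a) * w ^ DIM('a)))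
     = ennreal (unit_ball_vol DIM('a) * w ^ DIM('a)) * ennreal (unit_ball_vol DIM('a) * ((b - a) * b ^ (DIM('a) - 1)))"
    using assms w by (subst ennreal_mult[symmetric]) (auto simp: mult.commute)
  also have "\<dots> \<le> ennreal (unit_ball_vol DIM('a) * w ^ DIM('a)) * emeasure lborel A"
    unfolding A_def using assms by (intro mult_left_mono emeasure_shell_ge) auto
  also have "\<dots> = (\<integral>\<^sup>+ x. ennreal (unit_ball_vol DIM('a) * w ^ DIM('a)) * indicator A x \<partial>lborel)"
    using A by (subst nn_integral_cmult_indicator) auto
  also have "\<dots> \<le> (\<integral>\<^sup>+ x. emeasure lborel (Pair x -` ?T) \<partial>lborel)"
  proof (rule nn_integral_mono)
    fix x :: 'a
    have "Pair x -` ?T \<in> sets borel"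
      by (rule sets_Pair1[OF T'])
    then have "ennreal (unit_ball_vol DIM('a) * w ^ DIM('a)) \<le> emeasure lborel (Pair x -` ?T)" if "x \<in> A"
      using emeasure_mono[OF slice[OF that], of lborel] w by (simp add: emeasure_ball)
    then show "ennreal (unit_ball_vol DIM('a) * w ^ DIM('a)) * indicator A x \<le> emeasure lborel (Pair x -` ?T)"
      by (auto simp: indicator_def)
  qed
  also have "\<dots> = emeasure (lborel \<Otimes>\<^sub>M lborel) ?T"
    by (rule lborel.emeasure_pair_measure_alt[symmetric], subst lborel_prod, simp add: T)
  finally show ?thesis
    by (simp add: lborel_prod w_def)
qed

section \<open>Lebesgue measurability on the product space\<close>

text \<open>A function \<open>u\<close> that is only Lebesgue measurable is to be composed with the
  projection. Besides continuity this needs preimages of null sets to be null; these are products of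
  a null set with the whole space.\<close>

lemma measurable_fst_lebesgue:
  "(fst :: 'a::euclidean_space \<times> 'b::euclidean_space \<Rightarrow> 'a) \<in> lebesgue \<rightarrow>\<^sub>M lebesgue"
proof (rule completion.measurable_completion2)
  have "(fst :: 'a \<times> 'b \<Rightarrow> 'a) \<in> borel_measurable lborel"
    by (simp add: continuous_on_fst borel_measurable_continuous_onI)
  then show m: "(fst :: 'a \<times> 'b \<Rightarrow> 'a) \<in> lebesgue \<rightarrow>\<^sub>M lborel"
    by (simp add: measurable_completion)
  show "null_sets lborel \<subseteq> null_sets (distr lebesgue lborel (fst :: 'a \<times> 'b \<Rightarrow> 'a))"
  proof
    fix N :: "'a set" assume N: "N \<in> null_sets lborel"
    have "N \<times> (UNIV :: 'b set) \<in> null_sets (lborel \<Otimes>\<^sub>M lborel)"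
      by (rule lborel.times_in_null_sets1[OF N]) auto
    then have "N \<times> (UNIV :: 'b set) \<in> null_sets lebesgue"
      unfolding lborel_prod by (rule null_sets_completionI)
    moreover have "N \<times> (UNIV :: 'b set) = fst -` N" by auto
    ultimately show "N \<in> null_sets (distr lebesgue lborel (fst :: 'a \<times> 'b \<Rightarrow> 'a))"
      using N m by (auto simp: null_sets_def emeasure_distr)
  qed
qed

lemma measurable_snd_lebesgue:
  "(snd :: 'a::euclidean_space \<times> 'b::euclidean_space \<Rightarrow> 'b) \<in> lebesgue \<rightarrow>\<^sub>M lebesgue"
proof (rule completion.measurable_completion2)
  have "(snd :: 'a \<times> 'b \<Rightarrow> 'b) \<in> borel_measurable lborel"
    by (simp add: continuous_on_snd borel_measurable_continuous_onI)
  then show m: "(snd :: 'a \<times> 'b \<Rightarrow> 'b) \<in> lebesgue \<rightarrow>\<^sub>M lborel"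
    by (simp add: measurable_completion)
  show "null_sets lborel \<subseteq> null_sets (distr lebesgue lborel (snd :: 'a \<times> 'b \<Rightarrow> 'b))"
  proof
    fix N :: "'b set" assume N: "N \<in> null_sets lborel"
    have "(UNIV :: 'a set) \<times> N \<in> null_sets (lborel \<Otimes>\<^sub>M lborel)"
      by (rule lborel.times_in_null_sets2[OF _ N]) auto
    then have "(UNIV :: 'a set) \<times> N \<in> null_sets lebesgue"
      unfolding lborel_prod by (rule null_sets_completionI)
    moreover have "(UNIV :: 'a set) \<times> N = snd -` N" by auto
    ultimately show "N \<in> null_sets (distr lebesgue lborel (snd :: 'a \<times> 'b \<Rightarrow> 'b))"
      using N m by (auto simp: null_sets_def emeasure_distr)
  qed
qed

lemma gagliardo_quotient_measurable:
  fixes u :: "real ^ 'n \<Rightarrow> real"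
  assumes "u \<in> borel_measurable lebesgue"
  shows "(\<lambda>z. \<bar>u (fst z) - u (snd z)\<bar> ^ 2 / norm (fst z - snd z) powr p) \<in> borel_measurable lebesgue"
proof -
  have [measurable]: "(\<lambda>z. u (fst z)) \<in> borel_measurable (lebesgue :: ((real ^ 'n) \<times> (real ^ 'n)) measure)"
    "(\<lambda>z. u (snd z)) \<in> borel_measurable (lebesgue :: ((real ^ 'n) \<times> (real ^ 'n)) measure)"
    using measurable_compose[OF measurable_fst_lebesgue assms]
      measurable_compose[OF measurable_snd_lebesgue assms] by auto
  have "(\<lambda>z :: (real ^ 'n) \<times> (real ^ 'n). norm (fst z - snd z)) \<in> borel_measurable borel"
    by (intro borel_measurable_continuous_onI continuous_intros)
  then have [measurable]: "(\<lambda>z :: (real ^ 'n) \<times> (real ^ 'n). norm (fst z - snd z)) \<in> borel_measurable lebesgue"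
    by (simp add: measurable_completion)
  show ?thesis by measurable
qed

section \<open>From jumps of a radial function to a bound on its supremum\<close>

text \<open>The energy is at least the smallest value of the quotient on the close pairs times their
  measure. Only the first shell has to lie in \<open>\<Omega>\<close>, since
  \<open>cross_region\<close> excludes just the pairs with both points outside.\<close>

lemma gagliardo_energy_jump:
  fixes u :: "real ^ 'n \<Rightarrow> real" and a b c e D h s :: real
  defines "W \<equiv> unit_ball_vol CARD('n)"
  assumes "0 \<le> a" "a < b" "0 \<le> c" "c < e" "b - c \<le> D" "e - a \<le> D" "0 < s" "0 \<le> h"
    and \<Omega>: "\<And>x. a < norm x \<Longrightarrow> norm x < b \<Longrightarrow> x \<in> \<Omega>"
    and jump: "\<And>x y. a < norm x \<Longrightarrow> norm x < b \<Longrightarrow> c < norm y \<Longrightarrow> norm y < e \<Longrightarrow> h \<le> \<bar>u x - u y\<bar>"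
    and disj: "\<And>r. a < r \<Longrightarrow> r < b \<Longrightarrow> c < r \<Longrightarrow> r < e \<Longrightarrow> False"
  shows "ennreal (h ^ 2 / D powr (CARD('n) + 2 * s) *
      (W * ((b - a) * b ^ (CARD('n) - 1)) * (W * ((e - c) / 2) ^ CARD('n)))) \<le> gagliardo_energy s \<Omega> u"
proof -
  define T where "T = {z :: (real ^ 'n) \<times> (real ^ 'n).
        a < norm (fst z) \<and> norm (fst z) < b \<and> c < norm (snd z) \<and> norm (snd z) < e \<and>
        norm (fst z - snd z) < D}"
  define q where "q = h ^ 2 / D powr (CARD('n) + 2 * s)"
  have q: "0 \<le> q" unfolding q_def by simp
  have "open T"
    unfolding T_def by (intro open_Collect_conj open_Collect_less continuous_intros)
  then have T: "T \<in> sets lborel" by simp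
  have "ennreal (q * (W * ((b - a) * b ^ (CARD('n) - 1)) * (W * ((e - c) / 2) ^ CARD('n))))
      \<le> ennreal q * emeasure lborel T"
    unfolding T_def W_def using assms q
    by (subst ennreal_mult)
       (auto intro!: mult_left_mono emeasure_close_pairs_ge[where 'a = "real ^ 'n", simplified])
  also have "\<dots> = (\<integral>\<^sup>+ z. ennreal q * indicator T z \<partial>lebesgue)"
    using T by (subst nn_integral_cmult_indicator) auto
  also have "\<dots> \<le> gagliardo_energy s \<Omega> u"
    unfolding gagliardo_energy_def
  proof (rule nn_integral_mono, clarify)
    fix x y :: "real ^ 'n"
    show "ennreal q * indicator T (x, y) \<le>
       ennreal (\<bar>u x - u y\<bar> ^ 2 / norm (x - y) powr (real CARD('n) + 2 * s)) * indicator (cross_region \<Omega>) (x, y)"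
    proof (cases "(x, y) \<in> T")
      case True
      then have xy: "a < norm x" "norm x < b" "c < norm y" "norm y < e" "norm (x - y) < D"
        by (auto simp: T_def)
      \<comment> \<open>On the diagonal the quotient is \<open>0 / 0 = 0\<close>, so the lower bound
        could fail there; disjointness of the shells rules this out.\<close>
      have "x \<noteq> y" using disj[of "norm x"] xy by auto
      moreover have "h ^ 2 \<le> \<bar>u x - u y\<bar> ^ 2"
        using jump xy \<open>0 \<le> h\<close> by (intro power_mono) auto
      ultimately have "q \<le> \<bar>u x - u y\<bar> ^ 2 / norm (x - y) powr (real CARD('n) + 2 * s)"
        unfolding q_def using xy \<open>0 < s\<close>
        by (intro frac_le powr_mono2) auto
      moreover have "(x, y) \<in> cross_region \<Omega>"
        using \<Omega> xy by (auto simp: cross_region_def)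
      ultimately show ?thesis using True by (simp add: ennreal_leI)
    qed simp
  qed
  finally show ?thesis unfolding q_def .
qed

text \<open>Call \<open>\<sigma> * (norm x - e)\<close> the depth of \<open>x\<close>. Between the
  shells of depth \<open>\<tau> / 8\<close> to \<open>\<tau> / 4\<close> and
  \<open>\<tau> / 2\<close> to \<open>\<tau>\<close> the function drops by at least
  \<open>F (\<tau> / 4) - F (\<tau> / 2)\<close>. The pairs at distance below \<open>\<tau>\<close>
  have measure at least a multiple of the power n + 1 of \<open>\<tau>\<close>: one factor from the
  width of a shell, n from the ball. Against the power n + 2s in the kernel this leaves the exponent
  \<open>2 * s - 1\<close>. The lower bound \<open>\<beta>\<close> on the radii keeps the constant
  independent of \<open>\<tau>\<close>.\<close>

lemma dyadic_jump_bound: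
  fixes u :: "real ^ 'n \<Rightarrow> real" and F :: "real \<Rightarrow> real" and e \<sigma> \<tau> \<beta> s :: real
  assumes s: "0 < s" and \<sigma>: "\<sigma> = 1 \<or> \<sigma> = -1" and \<tau>: "0 < \<tau>" and \<beta>: "0 < \<beta>"
    and pos: "\<And>t. 0 < t \<Longrightarrow> t \<le> \<tau> \<Longrightarrow> \<beta> \<le> e + \<sigma> * t"
    and \<Omega>: "\<And>x. 0 < \<sigma> * (norm x - e) \<Longrightarrow> \<sigma> * (norm x - e) < \<tau> \<Longrightarrow> x \<in> \<Omega>"
    and u: "\<And>x. u x = F (\<sigma> * (norm x - e))" and F: "antimono_on {0<..\<tau>} F"
    and fin: "gagliardo_energy s \<Omega> u < \<infinity>"
  shows "(F (\<tau> / 4) - F (\<tau> / 2)) ^ 2 *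
      (unit_ball_vol CARD('n) ^ 2 * \<beta> ^ (CARD('n) - 1) / 2 / 16 ^ CARD('n))
    \<le> enn2real (gagliardo_energy s \<Omega> u) * \<tau> powr (2 * s - 1)"
proof -
  define W h where "W = unit_ball_vol CARD('n)" and "h = F (\<tau> / 4) - F (\<tau> / 2)"
  \<comment> \<open>For \<open>\<sigma> = -1\<close> the depth decreases as the radius grows, so the
    ends of each interval change places.\<close>
  define a b c d where
    "a = (if \<sigma> = 1 then e + \<tau> / 2 else e - \<tau>)" and
    "b = (if \<sigma> = 1 then e + \<tau> else e - \<tau> / 2)" and
    "c = (if \<sigma> = 1 then e + \<tau> / 8 else e - \<tau> / 4)" and
    "d = (if \<sigma> = 1 then e + \<tau> / 4 else e - \<tau> / 8)"
  note defs = a_def b_def c_def d_def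
  have W: "0 < W" by (simp add: W_def)
  have anti: "F y \<le> F x" if "0 < x" "x \<le> y" "y \<le> \<tau>" for x y
    using F that by (auto simp: monotone_on_def)
  have h: "0 \<le> h" using \<tau> anti[of "\<tau> / 4" "\<tau> / 2"] by (simp add: h_def)
  have ab: "b - a = \<tau> / 2" and cd: "d - c = \<tau> / 8"
    using \<tau> by (auto simp: defs field_simps)
  have b: "\<beta> \<le> b"
    using \<sigma> \<tau> pos[of \<tau>] pos[of "\<tau> / 2"] by (auto simp: defs)
  have jump: "ennreal (h ^ 2 / \<tau> powr (CARD('n) + 2 * s) *
      (W * ((b - a) * b ^ (CARD('n) - 1)) * (W * ((d - c) / 2) ^ CARD('n)))) \<le> gagliardo_energy s \<Omega> u"
    unfolding W_def
  proof (rule gagliardo_energy_jump[OF _ _ _ _ _ _ s h])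
    show "0 \<le> a" "0 \<le> c" "a < b" "c < d" "b - c \<le> \<tau>" "d - a \<le> \<tau>"
      using \<sigma> \<tau> \<beta> pos[of \<tau>] pos[of "\<tau> / 2"] pos[of "\<tau> / 4"] pos[of "\<tau> / 8"] by (auto simp: defs)
    fix x :: "real ^ 'n" assume x: "a < norm x" "norm x < b"
    then have tx: "\<tau> / 2 < \<sigma> * (norm x - e)" "\<sigma> * (norm x - e) < \<tau>"
      using \<sigma> \<tau> by (auto simp: defs)
    then show "x \<in> \<Omega>" using \<Omega> \<tau> by auto
    fix y :: "real ^ 'n" assume y: "c < norm y" "norm y < d"
    then have ty: "0 < \<sigma> * (norm y - e)" "\<sigma> * (norm y - e) < \<tau> / 4"
      using \<sigma> \<tau> by (auto simp: defs)
    have "u x \<le> F (\<tau> / 2)" unfolding u using tx \<tau> by (intro anti) auto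
    moreover have "F (\<tau> / 4) \<le> u y" unfolding u using ty \<tau> by (intro anti) auto
    ultimately show "h \<le> \<bar>u x - u y\<bar>" unfolding h_def by simp
  next
    fix r assume "a < r" "r < b" "c < r" "r < d"
    then show False using \<sigma> \<tau> by (auto simp: defs split: if_splits)
  qed
  have eq: "h ^ 2 / \<tau> powr (CARD('n) + 2 * s) *
      (W * ((b - a) * \<beta> ^ (CARD('n) - 1)) * (W * ((d - c) / 2) ^ CARD('n)))
     = h ^ 2 * (W ^ 2 * \<beta> ^ (CARD('n) - 1) / 2 / 16 ^ CARD('n)) / \<tau> powr (2 * s - 1)"
  proof -
    have "\<tau> powr (CARD('n) + 2 * s) = \<tau> ^ CARD('n) * \<tau> * \<tau> powr (2 * s - 1)"
      using \<tau> powr_mult_base[of \<tau> "2 * s - 1"] by (simp add: powr_add powr_realpow)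
    then show ?thesis
      unfolding ab cd using \<tau> by (simp add: field_simps power2_eq_square)
  qed
  have "h ^ 2 / \<tau> powr (CARD('n) + 2 * s) *
      (W * ((b - a) * \<beta> ^ (CARD('n) - 1)) * (W * ((d - c) / 2) ^ CARD('n)))
    \<le> h ^ 2 / \<tau> powr (CARD('n) + 2 * s) *
      (W * ((b - a) * b ^ (CARD('n) - 1)) * (W * ((d - c) / 2) ^ CARD('n)))"
    using W \<tau> \<beta> b unfolding ab cd by (intro mult_left_mono mult_right_mono power_mono) auto
  also have "\<dots> \<le> enn2real (gagliardo_energy s \<Omega> u)"
    using enn2real_mono[OF jump] fin W \<tau> \<beta> b unfolding ab cd by (auto simp: enn2real_ennreal)
  finally show ?thesis
    unfolding eq using \<tau> by (simp add: h_def W_def field_simps)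
qed

text \<open>
  Summing the jumps between consecutive dyadic shells at the endpoint replaces the Sobolev embedding;
  the exponent \<open>2 * s - 1 > 0\<close> makes the sum geometric.
\<close>

lemma monotone_profile_bound:
  fixes e \<sigma> L \<beta> s :: real
  assumes s: "1 / 2 < s" and \<sigma>: "\<sigma> = 1 \<or> \<sigma> = -1" and L: "0 < L" and \<beta>: "0 < \<beta>"
    and pos: "\<And>t. 0 < t \<Longrightarrow> t \<le> L \<Longrightarrow> \<beta> \<le> e + \<sigma> * t"
  obtains C where "0 < C"
    "\<And>(\<Omega> :: (real ^ 'n) set) u F t.
       (\<And>x. 0 < \<sigma> * (norm x - e) \<Longrightarrow> \<sigma> * (norm x - e) < L \<Longrightarrow> x \<in> \<Omega>) \<Longrightarrow>
       (\<And>x. u x = F (\<sigma> * (norm x - e))) \<Longrightarrow> antimono_on {0<..L} F \<Longrightarrow>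
       gagliardo_energy s \<Omega> u < \<infinity> \<Longrightarrow> 0 < t \<Longrightarrow> t \<le> L \<Longrightarrow>
       F t \<le> F (L / 2) + C * sqrt (enn2real (gagliardo_energy s \<Omega> u))"
proof -
  define c0 where "c0 = unit_ball_vol CARD('n) ^ 2 * \<beta> ^ (CARD('n) - 1) / 2 / 16 ^ CARD('n)"
  have c0: "0 < c0"
    unfolding c0_def using \<beta> by (intro divide_pos_pos mult_pos_pos zero_less_power) auto
  \<comment> \<open>Halving \<open>\<tau>\<close> multiplies the bound on the squared jump by
    \<open>(1 / 2) powr (2 * s - 1)\<close>; \<open>\<rho>\<close> is the resulting ratio for the
    jumps themselves.\<close>
  define \<rho> where "\<rho> = sqrt ((1 / 2) powr (2 * s - 1))"
  have "(1 / 2 :: real) powr (2 * s - 1) < (1 / 2) powr 0"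
    using s by (intro powr_less_mono') auto
  then have \<rho>: "0 < \<rho>" "\<rho> < 1" by (auto simp: \<rho>_def)
  define B where "B = sqrt (L powr (2 * s - 1) / c0)"
  have B: "0 < B" using L c0 by (simp add: B_def)
  show ?thesis
  proof (rule that)
    show "0 < B / (1 - \<rho>)" using B \<rho> by simp
    fix \<Omega> :: "(real ^ 'n) set" and u F t
    assume \<Omega>: "\<And>x. 0 < \<sigma> * (norm x - e) \<Longrightarrow> \<sigma> * (norm x - e) < L \<Longrightarrow> x \<in> \<Omega>"
      and u: "\<And>x. u x = F (\<sigma> * (norm x - e))" and F: "antimono_on {0<..L} F"
      and fin: "gagliardo_energy s \<Omega> u < \<infinity>" and t: "0 < t" "t \<le> L"
    define E where "E = enn2real (gagliardo_energy s \<Omega> u)"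
    have E: "0 \<le> E" by (simp add: E_def)
    have step: "F (L / 2 ^ (k + 2)) - F (L / 2 ^ (k + 1)) \<le> B * sqrt E * \<rho> ^ k" for k
    proof -
      define \<tau> where "\<tau> = L * (1 / 2) ^ k"
      have \<tau>: "0 < \<tau>" "\<tau> \<le> L"
        using L by (auto simp: \<tau>_def mult_le_cancel_left1 power_le_one)
      have \<tau>q: "\<tau> / 4 = L / 2 ^ (k + 2)" "\<tau> / 2 = L / 2 ^ (k + 1)"
        by (auto simp: \<tau>_def power_one_over)
      have "(F (\<tau> / 4) - F (\<tau> / 2)) ^ 2 * c0 \<le> E * \<tau> powr (2 * s - 1)"
        unfolding c0_def E_def
      proof (rule dyadic_jump_bound[OF _ \<sigma> \<tau>(1) \<beta> _ _ u _ fin])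
        show "antimono_on {0<..\<tau>} F"
          using F \<tau> by (auto simp: monotone_on_def)
      qed (use s pos \<Omega> \<tau> in auto)
      also have "\<tau> powr (2 * s - 1) = L powr (2 * s - 1) * ((1 / 2) powr (2 * s - 1)) ^ k"
        using L by (simp add: \<tau>_def powr_mult powr_powr mult.commute flip: powr_realpow)
      finally have "(F (\<tau> / 4) - F (\<tau> / 2)) ^ 2 \<le>
          L powr (2 * s - 1) / c0 * E * ((1 / 2) powr (2 * s - 1)) ^ k"
        using c0 by (simp add: field_simps)
      then have "F (\<tau> / 4) - F (\<tau> / 2) \<le> sqrt (L powr (2 * s - 1) / c0 * E * ((1 / 2) powr (2 * s - 1)) ^ k)"
        by (rule real_le_rsqrt)
      also have "\<dots> = B * sqrt E * \<rho> ^ k"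
        unfolding B_def \<rho>_def by (simp only: real_sqrt_mult real_sqrt_power)
      finally show ?thesis unfolding \<tau>q .
    qed
    have sum: "F (L / 2 ^ (k + 1)) \<le> F (L / 2) + B * sqrt E * (\<Sum>j<k. \<rho> ^ j)" for k
    proof (induction k)
      case (Suc k)
      then show ?case using step[of k] by (simp add: algebra_simps)
    qed simp
    \<comment> \<open>At a dyadic depth below \<open>t\<close> the decreasing \<open>F\<close> is at
      least \<open>F t\<close>. The number of jumps used depends on \<open>t\<close>, but the sum of
      the full geometric series does not.\<close>
    obtain k where "(1 / 2) ^ k < t / L"
      using real_arch_pow_inv[of "t / L" "1 / 2"] t L by auto
    then have "L / 2 ^ k < t" using L by (simp add: field_simps power_one_over)
    moreover have "L / 2 ^ (k + 1) \<le> L / 2 ^ k"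
      using L by (intro divide_left_mono power_increasing) auto
    ultimately have "F t \<le> F (L / 2 ^ (k + 1))"
      using F t L by (auto simp: monotone_on_def)
    also have "\<dots> \<le> F (L / 2) + B * sqrt E * (\<Sum>j<k. \<rho> ^ j)" by (rule sum)
    also have "(\<Sum>j<k. \<rho> ^ j) \<le> 1 / (1 - \<rho>)"
    proof -
      have "(\<Sum>j<k. \<rho> ^ j) \<le> (\<Sum>j. \<rho> ^ j)"
        using \<rho> by (intro sum_le_suminf summable_geometric) auto
      then show ?thesis using \<rho> by (simp add: suminf_geometric)
    qed
    then have "F (L / 2) + B * sqrt E * (\<Sum>j<k. \<rho> ^ j) \<le> F (L / 2) + B * sqrt E * (1 / (1 - \<rho>))"
      using B E by (intro add_left_mono mult_left_mono) auto
    finally show "F t \<le> F (L / 2) + B / (1 - \<rho>) * sqrt (enn2real (gagliardo_energy s \<Omega> u))"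
      by (simp add: E_def)
  qed
qed

section \<open>The normalization constant and the two test functions\<close>

text \<open>\<open>Gamma\<close> takes the value 0 exactly at the nonpositive integers, its poles,
  so the point is that \<open>- s\<close> is not an integer.\<close>

lemma frac_laplacian_const_pos:
  assumes "0 < n" "0 < s" "s < 1"
  shows "0 < frac_laplacian_const n s"
proof -
  have "- s \<notin> \<int>"
  proof
    assume "- s \<in> \<int>"
    then obtain k where "s = of_int k" by (metis Ints_cases Ints_minus minus_minus)
    then show False using assms by simp
  qed
  then have "- s \<notin> \<int>\<^sub>\<le>\<^sub>0" using nonpos_Ints_subset_Ints by blast
  then have "Gamma (- s) \<noteq> 0" by (simp add: Gamma_eq_zero_iff)
  moreover have "0 < Gamma (real n / 2 + s)" using assms by (intro Gamma_real_pos) auto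
  ultimately show ?thesis by (simp add: frac_laplacian_const_def)
qed

lemma cross_region_sets: "open \<Omega> \<Longrightarrow> cross_region \<Omega> \<in> sets lebesgue"
  by (simp add: cross_region_def closed_Times closed_Compl open_Diff borel_open)

text \<open>This links the Bochner integral of the weak formulation to the extended nonnegative
  integral defining the energy; the integrand is nonnegative and measurable.\<close>

lemma gagliardo_form_self:
  fixes u :: "real ^ 'n \<Rightarrow> real"
  assumes "open \<Omega>" "u \<in> borel_measurable lebesgue"
  shows "(LINT z:cross_region \<Omega>|lebesgue.
             (case z of (x, y) \<Rightarrow>
                (u x - u y) * (u x - u y) / norm (x - y) powr (real CARD('n) + 2 * s)))
    = enn2real (gagliardo_energy s \<Omega> u)"
proof -
  let ?q = "\<lambda>z. \<bar>u (fst z) - u (snd z)\<bar> ^ 2 / norm (fst z - snd z) powr (real CARD('n) + 2 * s)"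
  have "(LINT z:cross_region \<Omega>|lebesgue.
             (case z of (x, y) \<Rightarrow>
                (u x - u y) * (u x - u y) / norm (x - y) powr (real CARD('n) + 2 * s)))
     = (LINT z|lebesgue. indicator (cross_region \<Omega>) z * ?q z)"
    by (simp add: set_lebesgue_integral_def split_beta power2_eq_square)
  also have "\<dots> = enn2real (\<integral>\<^sup>+ z. ennreal (indicator (cross_region \<Omega>) z * ?q z) \<partial>lebesgue)"
    using cross_region_sets[OF assms(1)] gagliardo_quotient_measurable[OF assms(2)]
    by (intro integral_eq_nn_integral borel_measurable_times borel_measurable_indicator AE_I2) auto
  also have "(\<integral>\<^sup>+ z. ennreal (indicator (cross_region \<Omega>) z * ?q z) \<partial>lebesgue) = gagliardo_energy s \<Omega> u"
    unfolding gagliardo_energy_def by (intro nn_integral_cong) (auto simp: indicator_def)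
  finally show ?thesis .
qed

lemma set_integrable_const_lmeasurable:
  "\<Omega> \<in> lmeasurable \<Longrightarrow> set_integrable lebesgue \<Omega> (\<lambda>x. c :: real)"
  by (auto simp: set_integrable_def fmeasurable_def)

lemma weak_solution_test_one:
  fixes u :: "real ^ 'n \<Rightarrow> real"
  assumes \<Omega>: "open \<Omega>" "bounded \<Omega>" and M\<delta>: "0 < M" "0 < \<delta>"
    and g: "g \<in> nonlinearities M \<delta>" and sol: "weak_solution s \<Omega> g u"
  shows "set_integrable lebesgue \<Omega> u" "set_integrable lebesgue \<Omega> (\<lambda>x. g (u x))"
    "(LINT x:\<Omega>|lebesgue. g (u x)) = (LINT x:\<Omega>|lebesgue. u x)"
    "\<delta> * (LINT x:\<Omega>|lebesgue. u x) \<le> (1 + \<delta>) * M * measure lebesgue \<Omega>"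
proof -
  have lm: "\<Omega> \<in> lmeasurable" using \<Omega> by (intro lmeasurable_open)
  then have \<Omega>s: "\<Omega> \<in> sets lebesgue" by auto
  note const = set_integrable_const_lmeasurable[OF lm]
  have um: "u \<in> borel_measurable lebesgue" and u0: "\<And>x. 0 \<le> u x"
    using sol by (auto simp: weak_solution_def Hs_space_def)
  \<comment> \<open>The constant is square integrable because \<open>\<Omega>\<close> has finite
    measure, and its differences vanish, so its energy is 0 and the double integral drops out of the
    equation.\<close>
  have "(\<lambda>x. 1) \<in> Hs_space s \<Omega>"
    using const[of 1] by (simp add: Hs_space_def gagliardo_energy_def split_beta)
  then show gi: "set_integrable lebesgue \<Omega> (\<lambda>x. g (u x))"
    and eq: "(LINT x:\<Omega>|lebesgue. g (u x)) = (LINT x:\<Omega>|lebesgue. u x)"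
    using sol by (force simp: weak_solution_def split_beta)+
  have low: "(1 + \<delta>) * u x \<le> g (u x) + (1 + \<delta>) * M" for x
  proof (cases "M \<le> u x")
    case True
    then have "(1 + \<delta>) * u x \<le> g (u x)" using g u0 by (simp add: nonlinearities_def)
    then show ?thesis using M\<delta> by (smt (verit) mult_pos_pos)
  next
    case False
    then have "(1 + \<delta>) * u x \<le> (1 + \<delta>) * M" using M\<delta> by (intro mult_left_mono) auto
    moreover have "0 \<le> g (u x)" using g u0 by (simp add: nonlinearities_def)
    ultimately show ?thesis by simp
  qed
  have hi: "set_integrable lebesgue \<Omega> (\<lambda>x. g (u x) + (1 + \<delta>) * M)"
    using gi const by (intro set_integral_add)
  \<comment> \<open>Domination by \<open>g (u x)\<close> plus a constant suffices;
    \<open>g (u x)\<close> is integrable by the integrability clause of \<open>weak_solution\<close>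
    for the constant test function.\<close>
  show ui: "set_integrable lebesgue \<Omega> u"
  proof (rule set_integrable_bound[OF hi])
    show "set_borel_measurable lebesgue \<Omega> u"
      using um \<Omega>s unfolding set_borel_measurable_def by measurable
    have "u x \<le> (1 + \<delta>) * u x" for x using u0[of x] M\<delta> by (simp add: distrib_right)
    then have "u x \<le> g (u x) + (1 + \<delta>) * M" for x using low order_trans by blast
    then show "AE x in lebesgue. x \<in> \<Omega> \<longrightarrow> norm (u x) \<le> norm (g (u x) + (1 + \<delta>) * M)"
      using u0 by (intro AE_I2) (smt (verit) real_norm_def)
  qed
  have "(1 + \<delta>) * (LINT x:\<Omega>|lebesgue. u x) = (LINT x:\<Omega>|lebesgue. (1 + \<delta>) * u x)"
    by (rule set_integral_mult_right[symmetric])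
  also have "\<dots> \<le> (LINT x:\<Omega>|lebesgue. g (u x) + (1 + \<delta>) * M)"
    using ui hi low by (intro set_integral_mono) auto
  also have "\<dots> = (LINT x:\<Omega>|lebesgue. g (u x)) + (1 + \<delta>) * M * measure lebesgue \<Omega>"
    using gi const lm by (subst set_integral_add) (auto simp: set_integral_const fmeasurable_def algebra_simps)
  \<comment> \<open>The equality of the two integrals cancels one copy of the integral of
    \<open>u\<close> and leaves the factor \<open>\<delta>\<close>.\<close>
  finally show "\<delta> * (LINT x:\<Omega>|lebesgue. u x) \<le> (1 + \<delta>) * M * measure lebesgue \<Omega>"
    unfolding eq by (simp add: algebra_simps)
qed

text \<open>Since \<open>g (u x)\<close> is nonnegative, its factor \<open>u x\<close> may be
  replaced by \<open>S\<close>; the remaining integral of \<open>g (u x)\<close> is known from the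
  constant test function. In this way no growth bound from above on \<open>g\<close> enters.\<close>

lemma weak_solution_test_self:
  fixes u :: "real ^ 'n \<Rightarrow> real"
  assumes \<Omega>: "open \<Omega>" "bounded \<Omega>" and M\<delta>: "0 < M" "0 < \<delta>"
    and g: "g \<in> nonlinearities M \<delta>" and sol: "weak_solution s \<Omega> g u"
    and S: "\<And>x. x \<in> \<Omega> \<Longrightarrow> u x \<le> S"
  shows "frac_laplacian_const CARD('n) s / 2 * enn2real (gagliardo_energy s \<Omega> u)
      + (LINT x:\<Omega>|lebesgue. \<bar>u x\<bar> ^ 2) \<le> S * (LINT x:\<Omega>|lebesgue. u x)"
proof -
  have um: "u \<in> borel_measurable lebesgue" and uH: "u \<in> Hs_space s \<Omega>" and u0: "\<And>x. 0 \<le> u x"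
    using sol by (auto simp: weak_solution_def Hs_space_def)
  note one = weak_solution_test_one[OF \<Omega> M\<delta> g sol]
  have gu: "set_integrable lebesgue \<Omega> (\<lambda>x. g (u x) * u x)"
    and eq: "frac_laplacian_const CARD('n) s / 2 * enn2real (gagliardo_energy s \<Omega> u)
      + (LINT x:\<Omega>|lebesgue. u x * u x) = (LINT x:\<Omega>|lebesgue. g (u x) * u x)"
    using sol uH unfolding weak_solution_def gagliardo_form_self[OF \<Omega>(1) um, symmetric] by auto
  have "(LINT x:\<Omega>|lebesgue. g (u x) * u x) \<le> (LINT x:\<Omega>|lebesgue. S * g (u x))"
  proof (rule set_integral_mono[OF gu])
    show "set_integrable lebesgue \<Omega> (\<lambda>x. S * g (u x))" using one(2) by simp
    show "g (u x) * u x \<le> S * g (u x)" if "x \<in> \<Omega>" for x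
      using S[OF that] u0 g by (subst mult.commute) (auto intro!: mult_right_mono simp: nonlinearities_def)
  qed
  also have "\<dots> = S * (LINT x:\<Omega>|lebesgue. u x)" by (simp add: one(3))
  finally show ?thesis using eq by (simp add: power2_eq_square)
qed

section \<open>The a priori estimate for both cones at once\<close>

lemma apriori_bound:
  fixes e \<sigma> L \<beta> s M \<delta> :: real and \<Omega> :: "(real ^ 'n) set"
  assumes s: "1 / 2 < s" "s < 1" and \<sigma>: "\<sigma> = 1 \<or> \<sigma> = -1" and L: "0 < L" and \<beta>: "0 < \<beta>"
    and pos: "\<And>t. 0 < t \<Longrightarrow> t \<le> L \<Longrightarrow> \<beta> \<le> e + \<sigma> * t"
    and M\<delta>: "0 < M" "0 < \<delta>" and \<Omega>: "open \<Omega>" "bounded \<Omega>"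
    and inner: "\<And>x. 0 < \<sigma> * (norm x - e) \<Longrightarrow> \<sigma> * (norm x - e) < L \<Longrightarrow> x \<in> \<Omega>"
    and outer: "\<And>x. x \<in> \<Omega> \<Longrightarrow> 0 < \<sigma> * (norm x - e) \<and> \<sigma> * (norm x - e) \<le> 2 * L"
  obtains K1 K2 where "0 < K1" "0 < K2"
    "\<And>g u F. g \<in> nonlinearities M \<delta> \<Longrightarrow> (\<And>x. u x = F (\<sigma> * (norm x - e))) \<Longrightarrow>
       antimono_on {0..2 * L} F \<Longrightarrow> weak_solution s \<Omega> g u \<Longrightarrow>
       Linfty_norm \<Omega> u \<le> ereal K1 \<and> Hs_norm s \<Omega> u \<le> K2"
proof -
  obtain C where C: "0 < C" and profile:
    "\<And>(\<Omega> :: (real ^ 'n) set) u F t.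
       (\<And>x. 0 < \<sigma> * (norm x - e) \<Longrightarrow> \<sigma> * (norm x - e) < L \<Longrightarrow> x \<in> \<Omega>) \<Longrightarrow>
       (\<And>x. u x = F (\<sigma> * (norm x - e))) \<Longrightarrow> antimono_on {0<..L} F \<Longrightarrow>
       gagliardo_energy s \<Omega> u < \<infinity> \<Longrightarrow> 0 < t \<Longrightarrow> t \<le> L \<Longrightarrow>
       F t \<le> F (L / 2) + C * sqrt (enn2real (gagliardo_energy s \<Omega> u))"
    using monotone_profile_bound[OF s(1) \<sigma> L \<beta> pos, where 'n = 'n] by blast
  have lm: "\<Omega> \<in> lmeasurable" using \<Omega> by (intro lmeasurable_open)
  \<comment> \<open>On \<open>V\<close> the function is at least \<open>F (L / 2)\<close>, so the
    integral bound \<open>P\<close> for \<open>u\<close> yields the bound \<open>A\<close> for this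
    value. The point at depth \<open>L / 4\<close> shows that \<open>V\<close> is nonempty, hence of
    positive measure.\<close>
  define V where "V = {x :: real ^ 'n. 0 < \<sigma> * (norm x - e) \<and> \<sigma> * (norm x - e) < L / 2}"
  have V\<Omega>: "V \<subseteq> \<Omega>" using inner L by (auto simp: V_def)
  have "open V"
    unfolding V_def by (intro open_Collect_conj open_Collect_less continuous_intros)
  then have lmV: "V \<in> lmeasurable" using bounded_subset[OF \<Omega>(2) V\<Omega>] by (intro lmeasurable_open)
  obtain x :: "real ^ 'n" where "norm x = e + \<sigma> * (L / 4)"
    using vector_choose_size[of "e + \<sigma> * (L / 4)"] pos[of "L / 4"] L \<beta> by auto
  then have "x \<in> V" using \<sigma> L by (auto simp: V_def)
  then have "measure lebesgue V \<noteq> 0"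
    using open_not_negligible[OF \<open>open V\<close>] negligible_iff_measure0[OF lmV] by auto
  then have V: "0 < measure lebesgue V" by (simp add: zero_less_measure_iff)
  define \<kappa> where "\<kappa> = frac_laplacian_const CARD('n) s / 2"
  have \<kappa>: "0 < \<kappa>" using frac_laplacian_const_pos[of "CARD('n)" s] s by (simp add: \<kappa>_def)
  define P where "P = (1 + \<delta>) * M * measure lebesgue \<Omega> / \<delta>"
  have "measure lebesgue V \<le> measure lebesgue \<Omega>"
    using V\<Omega> lm lmV by (intro measure_mono_fmeasurable) auto
  then have P: "0 < P" using V M\<delta> by (simp add: P_def)
  define A where "A = P / measure lebesgue V"
  have A: "0 < A" using P V by (simp add: A_def)
  \<comment> \<open>The second term is what Young's inequality leaves of
    \<open>C * sqrt E * P\<close> once \<open>\<kappa> * E / 2\<close> has been split off to be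
    absorbed on the left.\<close>
  define Q where "Q = A * P + (C * P) ^ 2 / (2 * \<kappa>)"
  have Q: "0 < Q" using A P C \<kappa> by (simp add: Q_def add_pos_nonneg)
  show ?thesis
  proof (rule that)
    show "0 < A + C * sqrt (2 * Q / \<kappa>)" using A C Q \<kappa> by (simp add: add_pos_pos)
    show "0 < sqrt Q + sqrt (2 * Q)" using Q by (simp add: add_pos_pos)
    fix g u F
    assume g: "g \<in> nonlinearities M \<delta>" and u: "\<And>x. u x = F (\<sigma> * (norm x - e))"
      and F: "antimono_on {0..2 * L} F" and sol: "weak_solution s \<Omega> g u"
    have um: "u \<in> borel_measurable lebesgue" and u0: "\<And>x. 0 \<le> u x"
      and fin: "gagliardo_energy s \<Omega> u < \<infinity>"
      using sol by (auto simp: weak_solution_def Hs_space_def)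
    define E where "E = enn2real (gagliardo_energy s \<Omega> u)"
    have E: "0 \<le> E" by (simp add: E_def)
    note one = weak_solution_test_one[OF \<Omega> M\<delta> g sol]
    have intu: "(LINT x:\<Omega>|lebesgue. u x) \<le> P"
      using one(4) M\<delta> by (simp add: P_def field_simps)
    have "F (L / 2) * measure lebesgue V = (LINT x:V|lebesgue. F (L / 2))"
      using lmV by (subst set_integral_const) (auto simp: fmeasurable_def mult.commute)
    also have "\<dots> \<le> (LINT x:V|lebesgue. u x)"
    proof (rule set_integral_mono)
      show "set_integrable lebesgue V u"
        using one(1) lmV V\<Omega> by (intro set_integrable_subset[OF one(1)]) auto
      show "F (L / 2) \<le> u x" if "x \<in> V" for x
        unfolding u using that F L by (auto simp: V_def monotone_on_def)
    qed (rule set_integrable_const_lmeasurable[OF lmV])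
    also have "\<dots> \<le> (LINT x:\<Omega>|lebesgue. u x)"
    proof -
      have "set_integrable lebesgue V u"
        using lmV V\<Omega> by (intro set_integrable_subset[OF one(1)]) auto
      then show ?thesis
        using one(1) u0 V\<Omega> unfolding set_lebesgue_integral_def set_integrable_def
        by (intro integral_mono) (auto simp: indicator_def)
    qed
    finally have FA: "F (L / 2) \<le> A"
      using intu V by (simp add: A_def field_simps)
    have bound: "u x \<le> A + C * sqrt E" if "x \<in> \<Omega>" for x
    proof -
      \<comment> \<open>The cut at \<open>L\<close> keeps \<open>t\<close> in the range of the
        profile bound; deeper points have values at most \<open>F L\<close>.\<close>
      define t where "t = min (\<sigma> * (norm x - e)) L"
      have t: "0 < t" "t \<le> L" "t \<le> \<sigma> * (norm x - e)" "\<sigma> * (norm x - e) \<le> 2 * L"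
        using outer[OF that] L by (auto simp: t_def)
      then have "u x \<le> F t" unfolding u using F by (auto simp: monotone_on_def)
      also have "F t \<le> F (L / 2) + C * sqrt E"
        unfolding E_def
      proof (rule profile[OF inner u _ fin t(1,2)])
        show "antimono_on {0<..L} F" using F L by (auto simp: monotone_on_def)
      qed
      finally show ?thesis using FA by simp
    qed
    have "\<kappa> * E + (LINT x:\<Omega>|lebesgue. \<bar>u x\<bar> ^ 2) \<le> (A + C * sqrt E) * (LINT x:\<Omega>|lebesgue. u x)"
      using weak_solution_test_self[OF \<Omega> M\<delta> g sol bound] by (simp add: \<kappa>_def E_def)
    also have "\<dots> \<le> (A + C * sqrt E) * P"
      using A C E by (intro mult_left_mono[OF intu]) auto
    also have "\<dots> \<le> Q + \<kappa> * E / 2"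
    proof -
      have "0 \<le> (C * P - \<kappa> * sqrt E) ^ 2 / (2 * \<kappa>)" using \<kappa> by simp
      also have "\<dots> = (C * P) ^ 2 / (2 * \<kappa>) + \<kappa> * E / 2 - C * sqrt E * P"
        using \<kappa> E by (simp add: power2_diff power_mult_distrib field_simps power2_eq_square)
      finally show ?thesis by (simp add: Q_def algebra_simps)
    qed
    finally have main: "\<kappa> * E / 2 + (LINT x:\<Omega>|lebesgue. \<bar>u x\<bar> ^ 2) \<le> Q" by simp
    moreover have "0 \<le> (LINT x:\<Omega>|lebesgue. \<bar>u x\<bar> ^ 2)"
      by (simp add: set_lebesgue_integral_def)
    moreover have "0 \<le> \<kappa> * E" using \<kappa> E by simp
    ultimately have Eb: "\<kappa> * E \<le> 2 * Q" and ub: "(LINT x:\<Omega>|lebesgue. \<bar>u x\<bar> ^ 2) \<le> Q"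
      by linarith+
    have "sqrt E \<le> sqrt (2 * Q / \<kappa>)"
      using Eb \<kappa> by (simp add: field_simps)
    then have "A + C * sqrt E \<le> A + C * sqrt (2 * Q / \<kappa>)" using C by simp
    then have "u x \<le> A + C * sqrt (2 * Q / \<kappa>)" if "x \<in> \<Omega>" for x
      using bound[OF that] by linarith
    then have "Linfty_norm \<Omega> u \<le> ereal (A + C * sqrt (2 * Q / \<kappa>))"
      unfolding Linfty_norm_def using um u0 lm
      by (intro esssup_I AE_I2 borel_measurable_ereal measurable_restrict_space1) (auto simp: space_restrict_space)
    moreover have "Hs_norm s \<Omega> u \<le> sqrt Q + sqrt (2 * Q)"
      unfolding Hs_norm_def Hs_seminorm_def using Eb ub
      by (intro add_mono) (auto simp: \<kappa>_def E_def)
    ultimately show "Linfty_norm \<Omega> u \<le> ereal (A + C * sqrt (2 * Q / \<kappa>)) \<and>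
        Hs_norm s \<Omega> u \<le> sqrt Q + sqrt (2 * Q)" by simp
  qed
qed

section \<open>Application to the ball and the annulus\<close>

lemma open_radial_domain: "open (radial_domain R0 R :: (real ^ 'n) set)"
  unfolding radial_domain_def
  by (auto intro!: open_Collect_conj open_Collect_less continuous_intros)

lemma bounded_radial_domain: "bounded (radial_domain R0 R :: (real ^ 'n) set)"
  by (rule bounded_subset[of "cball 0 R"]) (auto simp: radial_domain_def)

theorem lemma3p5:
  fixes R0 R s M \<delta> :: real
  assumes "1 / 2 < s" "s < 1"
    and "0 \<le> R0" "R0 < R"
    and "0 < M" "0 < \<delta>"
  shows "\<exists>Kinf K2. 0 < Kinf \<and> 0 < K2 \<and>
    (\<forall>\<C> :: (real ^ 'n \<Rightarrow> real) set.
       \<C> = cone_plus s R0 R \<or> (0 < R0 \<and> \<C> = cone_minus s R0 R) \<longrightarrow>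
       (\<forall>g \<in> nonlinearities M \<delta>. \<forall>u \<in> \<C>.
          weak_solution s (radial_domain R0 R) g u \<longrightarrow>
          Linfty_norm (radial_domain R0 R) u \<le> ereal Kinf \<and>
          Hs_norm s (radial_domain R0 R) u \<le> K2))"
proof -
  define L where "L = (R - R0) / 2"
  have L: "0 < L" and R: "R = R0 + 2 * L" using assms by (auto simp: L_def field_simps)
  let ?\<Omega> = "radial_domain R0 R :: (real ^ 'n) set"
  define bounds where "bounds cone K1 K2 \<longleftrightarrow>
      0 < K1 \<and> 0 < K2 \<and> (\<forall>g \<in> nonlinearities M \<delta>. \<forall>u \<in> cone. weak_solution s ?\<Omega> g u \<longrightarrow>
        Linfty_norm ?\<Omega> u \<le> ereal K1 \<and> Hs_norm s ?\<Omega> u \<le> K2)" for cone and K1 K2 :: real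
  have plus: "\<exists>K1 K2. bounds (cone_plus s R0 R) K1 K2"
  proof -
    obtain K1 K2 where K: "0 < K1" "0 < K2"
      "\<And>g u F. g \<in> nonlinearities M \<delta> \<Longrightarrow> (\<And>x. u x = F (- 1 * (norm x - R))) \<Longrightarrow>
       antimono_on {0..2 * L} F \<Longrightarrow> weak_solution s ?\<Omega> g u \<Longrightarrow>
       Linfty_norm ?\<Omega> u \<le> ereal K1 \<and> Hs_norm s ?\<Omega> u \<le> K2"
    \<comment> \<open>The maximum is approached at the outer sphere, so \<open>e = R\<close>. Depths
      up to \<open>L\<close> correspond to radii at least \<open>R0 + L\<close>, so
      \<open>\<beta> = L\<close> works even for the ball.\<close>
    proof (rule apriori_bound[of s "- 1" L L R M \<delta> ?\<Omega>])
      show "\<And>x. 0 < - 1 * (norm x - R) \<Longrightarrow> - 1 * (norm x - R) < L \<Longrightarrow> x \<in> ?\<Omega>"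
        and "\<And>x. x \<in> ?\<Omega> \<Longrightarrow> 0 < - 1 * (norm x - R) \<and> - 1 * (norm x - R) \<le> 2 * L"
        using L by (auto simp: radial_domain_def R split: if_splits)
    qed (use assms L R open_radial_domain bounded_radial_domain in auto)
    have "Linfty_norm ?\<Omega> u \<le> ereal K1 \<and> Hs_norm s ?\<Omega> u \<le> K2"
      if g: "g \<in> nonlinearities M \<delta>" and u: "u \<in> cone_plus s R0 R" and sol: "weak_solution s ?\<Omega> g u" for g u
    proof -
      obtain f where f: "\<And>x. u x = f (norm x)" "mono_on {R0..R} f"
        using u by (auto simp: cone_plus_def)
      show ?thesis
      proof (rule K(3)[OF g _ _ sol])
        show "u x = (\<lambda>t. f (R - t)) (- 1 * (norm x - R))" for x by (simp add: f)
        show "antimono_on {0..2 * L} (\<lambda>t. f (R - t))"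
          using f(2) R by (auto simp: monotone_on_def)
      qed
    qed
    then show ?thesis using K unfolding bounds_def by blast
  qed
  have minus: "\<exists>K1 K2. bounds (cone_minus s R0 R) K1 K2" if R0: "0 < R0"
  proof -
    obtain K1 K2 where K: "0 < K1" "0 < K2"
      "\<And>g u F. g \<in> nonlinearities M \<delta> \<Longrightarrow> (\<And>x. u x = F (1 * (norm x - R0))) \<Longrightarrow>
       antimono_on {0..2 * L} F \<Longrightarrow> weak_solution s ?\<Omega> g u \<Longrightarrow>
       Linfty_norm ?\<Omega> u \<le> ereal K1 \<and> Hs_norm s ?\<Omega> u \<le> K2"
    \<comment> \<open>Now the inner sphere is the reference, \<open>e = R0\<close>, and the radii
      are bounded below by \<open>\<beta> = R0\<close>, positive for an annulus.\<close>
    proof (rule apriori_bound[of s 1 L R0 R0 M \<delta> ?\<Omega>])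
      show "\<And>x. 0 < 1 * (norm x - R0) \<Longrightarrow> 1 * (norm x - R0) < L \<Longrightarrow> x \<in> ?\<Omega>"
        and "\<And>x. x \<in> ?\<Omega> \<Longrightarrow> 0 < 1 * (norm x - R0) \<and> 1 * (norm x - R0) \<le> 2 * L"
        using L R0 by (auto simp: radial_domain_def R split: if_splits)
    qed (use assms L R0 open_radial_domain bounded_radial_domain in auto)
    have "Linfty_norm ?\<Omega> u \<le> ereal K1 \<and> Hs_norm s ?\<Omega> u \<le> K2"
      if g: "g \<in> nonlinearities M \<delta>" and u: "u \<in> cone_minus s R0 R" and sol: "weak_solution s ?\<Omega> g u" for g u
    proof -
      obtain f where f: "\<And>x. u x = f (norm x)" "antimono_on {R0..R} f"
        using u by (auto simp: cone_minus_def)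
      show ?thesis
      proof (rule K(3)[OF g _ _ sol])
        show "u x = (\<lambda>t. f (R0 + t)) (1 * (norm x - R0))" for x by (simp add: f)
        show "antimono_on {0..2 * L} (\<lambda>t. f (R0 + t))"
          using f(2) R by (auto simp: monotone_on_def)
      qed
    qed
    then show ?thesis using K unfolding bounds_def by blast
  qed
  obtain K1 K2 where K: "bounds (cone_plus s R0 R) K1 K2" using plus by blast
  \<comment> \<open>For the ball nothing is known about \<open>K1'\<close> and \<open>K2'\<close>,
    not even their sign; taking maxima with \<open>K1\<close> and \<open>K2\<close> still gives
    positive constants.\<close>
  obtain K1' K2' where K': "0 < R0 \<Longrightarrow> bounds (cone_minus s R0 R) K1' K2'" using minus by blast
  have "bounds (cone_plus s R0 R) (max K1 K1') (max K2 K2')"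
    using K unfolding bounds_def by (fastforce simp: max_def intro: order_trans)
  moreover have "0 < R0 \<Longrightarrow> bounds (cone_minus s R0 R) (max K1 K1') (max K2 K2')"
    using K' unfolding bounds_def by (fastforce simp: max_def intro: order_trans)
  ultimately show ?thesis
    unfolding bounds_def by (intro exI[of _ "max K1 K1'"] exI[of _ "max K2 K2'"]) blast
qed

end
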